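(* Let $X$ be a metrizable, separable, locally compact space, let $\mathcal F=\{f_1,\dots,f_m\}$ be an iterated function system on $X$ with compact dynamics, and let $\mathcal G_{\mathcal F}$ be its global attractor. Let $\mathcal F|_{\mathcal G_{\mathcal F}}=\{f_1|_{\mathcal G_{\mathcal F}},\dots,f_m|_{\mathcal G_{\mathcal F}}\}$ be the restricted IFS on the compact space $\mathcal G_{\mathcal F}$. Then $$\mathcal C_{\mathcal F}\cap(\mathcal G_{\mathcal F}\times\mathcal G_{\mathcal F})=\mathcal C_{\mathcal F|_{\mathcal G_{\mathcal F}}}.$$ In particular, the chain-recurrent set, the chain nodes and the chain graph of $\mathcal F$ coincide with those of $\mathcal F|_{\mathcal G_{\mathcal F}}$, and likewise the orbitwise chain-recurrent set, the orbitwise chain nodes and the orbitwise chain graph of $\mathcal F$ coincide with those of $\mathcal F|_{\mathcal G_{\mathcal F}}$.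
   Context: Fix any metric $d$ on $X$ compatible with its topology (restricted to subsets when needed). An iterated function system (IFS) on $X$ is a finite collection $\mathcal F=\{f_1,\dots,f_m\}$, $m\ge1$, of continuous maps $X\to X$. $\mathcal I^m$ is the set of all finite words in the letters $1,\dots,m$ (including the empty word $0$); $|I|$ is the length of $I$. For $I=i_1\cdots i_k$, $\Phi^I_{\mathcal F}=f_{i_k}\circ\dots\circ f_{i_1}$, and $\Phi^0_{\mathcal F}=\mathrm{id}_X$. For $A\subset X$, $H_{\mathcal F}(A)=\bigcup_{i=1}^m f_i(A)$; $A$ is $H$-invariant if $H_{\mathcal F}(A)=A$. The orbit of $x$ is $\mathcal O_{\mathcal F}(x)=\{\Phi^I_{\mathcal F}(x): I\in\mathcal I^m\}$. $N_\varepsilon(A)=\{x:d(x,A)<\varepsilon\}$. $A$ attracts $K$ if for every $\varepsilon>0$ there is $\tau>0$ with $\Phi^I_{\mathcal F}(K)\subset N_\varepsilon(A)$ for every $|I|\ge\tau$. A global attractor is a compact $H$-invariant set that attracts every compact subset of $X$; it is unique if it exists and is denoted $\mathcal G_{\mathcal F}$. $\mathcal F$ has compact dynamics if it has a global attractor. Chains: an $\varepsilon$-chain from $x$ to $y$ is a finite sequence $x_0=x,x_1,\dots,x_k=y$ ($k\ge0$) of points of $X$ with indices $i_0,\dots,i_{k-1}\in\{1,\dots,m\}$ such that $d(f_{i_n}(x_n),x_{n+1})<\varepsilon$ for $n=0,\dots,k-1$. The chain stream is $\mathcal C_{\mathcal F}=\{(x,y):$ for every $\varepsilon>0$ there is an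 $\varepsilon$-chain from $x$ to $y\}$. Write $x\succcurlyeq y$ for $(x,y)\in\mathcal C_{\mathcal F}$; $x,y$ are chain-equivalent if $x\succcurlyeq y$ and $y\succcurlyeq x$. A point $x$ is chain-recurrent if $x$ is chain-equivalent to $f_i(x)$ for some $i$; it is orbitwise chain-recurrent if it is chain-equivalent to every point of $\mathcal O_{\mathcal F}(x)$. Chain nodes (resp. orbitwise chain nodes) are the chain-equivalence classes of the set of chain-recurrent (resp. orbitwise chain-recurrent) points. The chain graph (resp. orbitwise chain graph) is the directed graph whose vertices are the chain nodes (resp. orbitwise chain nodes), with an edge from $N_1$ to $N_2\ne N_1$ when $x\succcurlyeq y$ for some $x\in N_1$, $y\in N_2$. *)

theory Defs
  imports "HOL-Analysis.Analysis" "Graph_Theory.Pair_Digraph"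
begin

text \<open>
  An IFS is given by a metric space \<open>D\<close> (carrier \<open>mspace D\<close>, distance \<open>mdist D\<close>) and a family
  \<open>f 1, \<dots>, f m\<close> of continuous self-maps. Everything is relative to the carrier of \<open>D\<close>, so that
  the same notions apply to an IFS and to its restrictions; only the values of \<open>f i\<close> with
  \<open>i \<in> {1..m}\<close> at points of \<open>mspace D\<close> matter.
\<close>

definition ifs :: "'a metric \<Rightarrow> nat \<Rightarrow> (nat \<Rightarrow> 'a \<Rightarrow> 'a) \<Rightarrow> bool" where
  "ifs D m f \<longleftrightarrow>
     m \<ge> 1 \<and> (\<forall>i\<in>{1..m}. continuous_map (mtopology_of D) (mtopology_of D) (f i))"

definition words :: "nat \<Rightarrow> nat list set" where
  "words m = lists {1..m}"

text \<open>For a word \<open>I = [i\<^sub>1, \<dots>, i\<^sub>k]\<close> this is the map \<open>f i\<^sub>k \<circ> \<dots> \<circ> f i\<^sub>1\<close>: the first letter acts first.\<close>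

definition word_map :: "(nat \<Rightarrow> 'a \<Rightarrow> 'a) \<Rightarrow> nat list \<Rightarrow> 'a \<Rightarrow> 'a" where
  "word_map f I = fold f I"

definition hutchinson :: "nat \<Rightarrow> (nat \<Rightarrow> 'a \<Rightarrow> 'a) \<Rightarrow> 'a set \<Rightarrow> 'a set" where
  "hutchinson m f A = (\<Union>i\<in>{1..m}. f i ` A)"

definition ifs_orbit :: "nat \<Rightarrow> (nat \<Rightarrow> 'a \<Rightarrow> 'a) \<Rightarrow> 'a \<Rightarrow> 'a set" where
  "ifs_orbit m f x = {word_map f I x |I. I \<in> words m}"

text \<open>The distance to a set is an infimum in \<open>ereal\<close>, so that \<open>d(x, {}) = \<infinity>\<close> and the neighbourhoods
  of the empty set are empty.\<close>

definition nbhd :: "'a metric \<Rightarrow> real \<Rightarrow> 'a set \<Rightarrow> 'a set" where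
  "nbhd D \<epsilon> A = {x \<in> mspace D. (INF a\<in>A. ereal (mdist D x a)) < ereal \<epsilon>}"

definition attracts :: "'a metric \<Rightarrow> nat \<Rightarrow> (nat \<Rightarrow> 'a \<Rightarrow> 'a) \<Rightarrow> 'a set \<Rightarrow> 'a set \<Rightarrow> bool" where
  "attracts D m f A K \<longleftrightarrow>
     (\<forall>\<epsilon>>0. \<exists>\<tau>>0. \<forall>I\<in>words m. \<tau> \<le> length I \<longrightarrow> word_map f I ` K \<subseteq> nbhd D \<epsilon> A)"

definition global_attractor :: "'a metric \<Rightarrow> nat \<Rightarrow> (nat \<Rightarrow> 'a \<Rightarrow> 'a) \<Rightarrow> 'a set \<Rightarrow> bool" where
  "global_attractor D m f A \<longleftrightarrow>
     compactin (mtopology_of D) A \<and> hutchinson m f A = A \<and>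
     (\<forall>K. compactin (mtopology_of D) K \<longrightarrow> attracts D m f A K)"

definition compact_dynamics :: "'a metric \<Rightarrow> nat \<Rightarrow> (nat \<Rightarrow> 'a \<Rightarrow> 'a) \<Rightarrow> bool" where
  "compact_dynamics D m f \<longleftrightarrow> (\<exists>A. global_attractor D m f A)"

definition eps_chain ::
  "'a metric \<Rightarrow> nat \<Rightarrow> (nat \<Rightarrow> 'a \<Rightarrow> 'a) \<Rightarrow> real \<Rightarrow> nat \<Rightarrow> (nat \<Rightarrow> 'a) \<Rightarrow> (nat \<Rightarrow> nat) \<Rightarrow> 'a \<Rightarrow> 'a \<Rightarrow> bool"
where
  "eps_chain D m f \<epsilon> k xs is x y \<longleftrightarrow>
     xs 0 = x \<and> xs k = y \<and> (\<forall>n\<le>k. xs n \<in> mspace D) \<and>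
     (\<forall>n<k. is n \<in> {1..m} \<and> mdist D (f (is n) (xs n)) (xs (Suc n)) < \<epsilon>)"

definition chain_stream :: "'a metric \<Rightarrow> nat \<Rightarrow> (nat \<Rightarrow> 'a \<Rightarrow> 'a) \<Rightarrow> 'a rel" where
  "chain_stream D m f = {(x, y). \<forall>\<epsilon>>0. \<exists>k xs is. eps_chain D m f \<epsilon> k xs is x y}"

definition chain_equiv :: "'a metric \<Rightarrow> nat \<Rightarrow> (nat \<Rightarrow> 'a \<Rightarrow> 'a) \<Rightarrow> 'a \<Rightarrow> 'a \<Rightarrow> bool" where
  "chain_equiv D m f x y \<longleftrightarrow> (x, y) \<in> chain_stream D m f \<and> (y, x) \<in> chain_stream D m f"

definition chain_recurrent_set :: "'a metric \<Rightarrow> nat \<Rightarrow> (nat \<Rightarrow> 'a \<Rightarrow> 'a) \<Rightarrow> 'a set" where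
  "chain_recurrent_set D m f = {x \<in> mspace D. \<exists>i\<in>{1..m}. chain_equiv D m f x (f i x)}"

definition orbitwise_chain_recurrent_set :: "'a metric \<Rightarrow> nat \<Rightarrow> (nat \<Rightarrow> 'a \<Rightarrow> 'a) \<Rightarrow> 'a set" where
  "orbitwise_chain_recurrent_set D m f =
     {x \<in> mspace D. \<forall>y\<in>ifs_orbit m f x. chain_equiv D m f x y}"

definition chain_classes :: "'a metric \<Rightarrow> nat \<Rightarrow> (nat \<Rightarrow> 'a \<Rightarrow> 'a) \<Rightarrow> 'a set \<Rightarrow> 'a set set" where
  "chain_classes D m f R = R // {(x, y). x \<in> R \<and> y \<in> R \<and> chain_equiv D m f x y}"

definition chain_nodes :: "'a metric \<Rightarrow> nat \<Rightarrow> (nat \<Rightarrow> 'a \<Rightarrow> 'a) \<Rightarrow> 'a set set" where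
  "chain_nodes D m f = chain_classes D m f (chain_recurrent_set D m f)"

definition orbitwise_chain_nodes :: "'a metric \<Rightarrow> nat \<Rightarrow> (nat \<Rightarrow> 'a \<Rightarrow> 'a) \<Rightarrow> 'a set set" where
  "orbitwise_chain_nodes D m f = chain_classes D m f (orbitwise_chain_recurrent_set D m f)"

definition node_graph ::
  "'a metric \<Rightarrow> nat \<Rightarrow> (nat \<Rightarrow> 'a \<Rightarrow> 'a) \<Rightarrow> 'a set set \<Rightarrow> 'a set pair_pre_digraph" where
  "node_graph D m f \<N> =
     \<lparr>pverts = \<N>,
      parcs = {(N\<^sub>1, N\<^sub>2). N\<^sub>1 \<in> \<N> \<and> N\<^sub>2 \<in> \<N> \<and> N\<^sub>2 \<noteq> N\<^sub>1 \<and>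
                 (\<exists>x\<in>N\<^sub>1. \<exists>y\<in>N\<^sub>2. (x, y) \<in> chain_stream D m f)}\<rparr>"

definition chain_graph :: "'a metric \<Rightarrow> nat \<Rightarrow> (nat \<Rightarrow> 'a \<Rightarrow> 'a) \<Rightarrow> 'a set pair_pre_digraph" where
  "chain_graph D m f = node_graph D m f (chain_nodes D m f)"

definition orbitwise_chain_graph ::
  "'a metric \<Rightarrow> nat \<Rightarrow> (nat \<Rightarrow> 'a \<Rightarrow> 'a) \<Rightarrow> 'a set pair_pre_digraph" where
  "orbitwise_chain_graph D m f = node_graph D m f (orbitwise_chain_nodes D m f)"

text \<open>To be paired with \<open>submetric D A\<close>, which is the restricted IFS on an invariant set \<open>A\<close>.\<close>

definition restrict_maps :: "'a set \<Rightarrow> (nat \<Rightarrow> 'a \<Rightarrow> 'a) \<Rightarrow> nat \<Rightarrow> 'a \<Rightarrow> 'a" where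
  "restrict_maps A f = (\<lambda>i. restrict (f i) A)"

lemma word_covering:
  assumes "hutchinson m f A = A" and "x \<in> A"
  shows "\<exists>I\<in>words m. length I = n \<and> x \<in> word_map f I ` A"
  using assms(2)
proof (induction n arbitrary: x)
  case 0
  then show ?case by (intro bexI[of _ "[]"]) (auto simp: words_def word_map_def)
next
  case (Suc n)
  from Suc.prems assms(1) obtain i z where i: "i \<in> {1..m}" "z \<in> A" "x = f i z"
    unfolding hutchinson_def by blast
  from Suc.IH[OF i(2)] obtain I where I: "I \<in> words m" "length I = n" "z \<in> word_map f I ` A"
    by blast
  show ?case
    by (rule bexI[of _ "I @ [i]"]) (use i I in \<open>auto simp: words_def word_map_def image_iff\<close>)
qed

lemma mem_closed_if_mem_nbhds:
  assumes cl: "closedin (mtopology_of D) A" and x: "x \<in> mspace D"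
    and near: "\<And>\<epsilon>. \<epsilon> > 0 \<Longrightarrow> x \<in> nbhd D \<epsilon> A"
  shows "x \<in> A"
proof (rule ccontr)
  interpret Metric_space "mspace D" "mdist D" by simp
  assume "x \<notin> A"
  then obtain r where r: "r > 0" "mball x r \<subseteq> mspace D - A"
    using cl x openin_mtopology unfolding mtopology_of_def closedin_def
    by (metis Diff_iff topspace_mtopology)
  from near[OF r(1)] obtain a where a: "a \<in> A" "mdist D x a < r"
    by (auto simp: nbhd_def INF_less_iff)
  have "a \<in> mspace D" using a(1) cl closedin_subset by (fastforce simp: mtopology_of_def)
  then show False using a x r by (auto simp: subset_iff in_mball)
qed

lemma global_attractor_subset:
  assumes A: "global_attractor D m f A" and B: "global_attractor D m f B"
  shows "B \<subseteq> A"
proof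
  fix x assume x: "x \<in> B"
  interpret Metric_space "mspace D" "mdist D" by simp
  have sub: "B \<subseteq> mspace D"
    using B compactin_subset_topspace by (fastforce simp: global_attractor_def)
  have cl: "closedin (mtopology_of D) A"
    using A compactin_imp_closedin Hausdorff_space_mtopology
    by (auto simp: global_attractor_def mtopology_of_def)
  show "x \<in> A"
  proof (rule mem_closed_if_mem_nbhds[OF cl])
    show "x \<in> mspace D" using x sub by blast
    fix \<epsilon> :: real assume "\<epsilon> > 0"
    moreover have "attracts D m f A B" using A B by (auto simp: global_attractor_def)
    ultimately obtain \<tau> where \<tau>: "\<forall>I\<in>words m. \<tau> \<le> length I \<longrightarrow> word_map f I ` B \<subseteq> nbhd D \<epsilon> A"
      unfolding attracts_def by blast
    obtain I where "I \<in> words m" "length I = \<tau>" "x \<in> word_map f I ` B"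
      using word_covering[of m f B x \<tau>] B x by (auto simp: global_attractor_def)
    with \<tau> show "x \<in> nbhd D \<epsilon> A" by blast
  qed
qed

lemma global_attractor_unique:
  "global_attractor D m f A \<Longrightarrow> global_attractor D m f B \<Longrightarrow> A = B"
  by (simp add: global_attractor_subset subset_antisym)

lemma ifs_restrict:
  assumes "ifs D m f" and "A \<subseteq> mspace D" and "hutchinson m f A = A"
  shows "ifs (submetric D A) m (restrict_maps A f)"
proof -
  have top: "mtopology_of (submetric D A) = subtopology (mtopology_of D) A"
    by (simp add: mtopology_of_submetric)
  have "continuous_map (subtopology (mtopology_of D) A) (subtopology (mtopology_of D) A)
          (restrict (f i) A)" if "i \<in> {1..m}" for i
  proof -
    have "continuous_map (subtopology (mtopology_of D) A) (mtopology_of D) (f i)"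
      using assms(1) that by (auto simp: ifs_def intro: continuous_map_from_subtopology)
    moreover have "f i ` A \<subseteq> A" using assms(3) that unfolding hutchinson_def by blast
    ultimately have "continuous_map (subtopology (mtopology_of D) A)
        (subtopology (mtopology_of D) A) (f i)"
      by (auto simp: continuous_map_in_subtopology)
    then show ?thesis
      by (rule continuous_map_eq) auto
  qed
  then show ?thesis using assms(1) by (simp add: ifs_def top restrict_maps_def)
qed

end

theory Submission
  imports Defs
begin

text \<open>
  Let \<open>K\<close> be a compact neighbourhood of the attractor \<open>G\<close>. The iterates of length \<open>\<ge> T\<close> send
  \<open>K\<close> close to \<open>G\<close>, and over at most \<open>2T\<close> steps a sufficiently fine chain starting in a given
  compact set is shadowed by a true orbit. Restarting the shadowing \<open>T\<close> steps before the current
  time shows inductively that a fine chain never leaves a small neighbourhood of \<open>G\<close> if it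
  starts in \<open>G\<close>, and does not leave it after time \<open>T\<close> if it starts elsewhere. In the first case the
  points of the chain can be moved into \<open>G\<close> at small cost. In the second case, running around an
  arbitrarily long closed chain shows that chain-recurrent points lie in \<open>G\<close>.
\<close>

section \<open>Chains as powers of a relation\<close>

text \<open>With chains written as \<open>chain_step D m f \<epsilon> ^^ n\<close>, cutting, joining
  and repeating them reduce to facts about relational powers. Both endpoints are required to lie in
  the space, so every chain of positive length stays in it.\<close>

definition chain_step :: "'a metric \<Rightarrow> nat \<Rightarrow> (nat \<Rightarrow> 'a \<Rightarrow> 'a) \<Rightarrow> real \<Rightarrow> 'a rel" where
  "chain_step D m f \<epsilon> =
     {(a, b). a \<in> mspace D \<and> b \<in> mspace D \<and> (\<exists>i\<in>{1..m}. mdist D (f i a) b < \<epsilon>)}"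

lemma chain_step_mono: "\<epsilon> \<le> \<epsilon>' \<Longrightarrow> chain_step D m f \<epsilon> \<subseteq> chain_step D m f \<epsilon>'"
  by (force simp: chain_step_def)

lemma relpow_mono_subset: "R \<subseteq> S \<Longrightarrow> (R :: 'a rel) ^^ n \<subseteq> S ^^ n"
  by (induction n) auto

lemma chain_step_relpow_mono:
  "(x, y) \<in> chain_step D m f \<epsilon> ^^ n \<Longrightarrow> \<epsilon> \<le> \<epsilon>' \<Longrightarrow> (x, y) \<in> chain_step D m f \<epsilon>' ^^ n"
  by (rule subsetD[OF relpow_mono_subset[OF chain_step_mono]])

lemma chain_step_relpow_in_mspace:
  "(x, y) \<in> chain_step D m f \<epsilon> ^^ n \<Longrightarrow> x \<in> mspace D \<Longrightarrow> y \<in> mspace D"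
  by (cases n) (auto simp: chain_step_def)

text \<open>The condition \<open>x \<in> mspace D\<close> is kept because the zeroth power of a
  relation is the identity on the whole type, while a chain of length 0 must still start in the
  space.\<close>

lemma ex_eps_chain_iff:
  "(\<exists>xs is. eps_chain D m f \<epsilon> k xs is x y) \<longleftrightarrow>
     x \<in> mspace D \<and> (x, y) \<in> chain_step D m f \<epsilon> ^^ k"
proof
  assume "\<exists>xs is. eps_chain D m f \<epsilon> k xs is x y"
  then obtain xs "is" where *: "eps_chain D m f \<epsilon> k xs is x y" by blast
  have "\<forall>n<k. (xs n, xs (Suc n)) \<in> chain_step D m f \<epsilon>"
    using * unfolding eps_chain_def chain_step_def by auto
  then show "x \<in> mspace D \<and> (x, y) \<in> chain_step D m f \<epsilon> ^^ k"
    using * unfolding relpow_fun_conv eps_chain_def by auto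
next
  assume *: "x \<in> mspace D \<and> (x, y) \<in> chain_step D m f \<epsilon> ^^ k"
  then obtain xs where xs: "xs 0 = x" "xs k = y"
    "\<forall>n<k. (xs n, xs (Suc n)) \<in> chain_step D m f \<epsilon>"
    unfolding relpow_fun_conv by blast
  have "\<forall>n. \<exists>i. n < k \<longrightarrow> i \<in> {1..m} \<and> mdist D (f i (xs n)) (xs (Suc n)) < \<epsilon>"
    using xs(3) unfolding chain_step_def by blast
  then obtain "is" where "\<forall>n<k. is n \<in> {1..m} \<and> mdist D (f (is n) (xs n)) (xs (Suc n)) < \<epsilon>"
    by metis
  moreover have "xs n \<in> mspace D" if "n \<le> k" for n
    using xs * that by (cases n) (auto simp: chain_step_def)
  ultimately have "eps_chain D m f \<epsilon> k xs is x y"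
    using xs unfolding eps_chain_def by blast
  then show "\<exists>xs is. eps_chain D m f \<epsilon> k xs is x y" by blast
qed

lemma chain_stream_iff:
  "(x, y) \<in> chain_stream D m f \<longleftrightarrow>
     x \<in> mspace D \<and> (\<forall>\<epsilon>>0. \<exists>k. (x, y) \<in> chain_step D m f \<epsilon> ^^ k)"
  unfolding chain_stream_def using ex_eps_chain_iff[of D m f] by (auto intro: zero_less_one)

lemma chain_stream_subset_mspace: "chain_stream D m f \<subseteq> mspace D \<times> mspace D"
proof (intro subrelI SigmaI)
  fix x y assume "(x, y) \<in> chain_stream D m f"
  then obtain k where k: "x \<in> mspace D" "(x, y) \<in> chain_step D m f 1 ^^ k"
    unfolding chain_stream_iff using zero_less_one by metis
  then show "x \<in> mspace D" "y \<in> mspace D"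
    using chain_step_relpow_in_mspace by metis+
qed

section \<open>Neighbourhoods, words and invariance\<close>

lemma mem_nbhd_iff: "x \<in> nbhd D \<epsilon> A \<longleftrightarrow> x \<in> mspace D \<and> (\<exists>a\<in>A. mdist D x a < \<epsilon>)"
  by (auto simp: nbhd_def INF_less_iff)

lemma word_map_Nil [simp]: "word_map f [] x = x"
  by (simp add: word_map_def)

lemma word_map_snoc [simp]: "word_map f (I @ [i]) x = f i (word_map f I x)"
  by (simp add: word_map_def)

lemma Nil_in_words [simp]: "[] \<in> words m"
  by (simp add: words_def)

lemma snoc_in_words_iff [simp]: "I @ [i] \<in> words m \<longleftrightarrow> I \<in> words m \<and> i \<in> {1..m}"
  by (auto simp: words_def)

lemma ifs_maps_space: "ifs D m f \<Longrightarrow> i \<in> {1..m} \<Longrightarrow> x \<in> mspace D \<Longrightarrow> f i x \<in> mspace D"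
  unfolding ifs_def using continuous_map_image_subset_topspace by fastforce

lemma word_map_in:
  assumes "\<And>i x. i \<in> {1..m} \<Longrightarrow> x \<in> A \<Longrightarrow> f i x \<in> A"
  shows "I \<in> words m \<Longrightarrow> x \<in> A \<Longrightarrow> word_map f I x \<in> A"
  by (induction I rule: rev_induct) (auto intro: assms)

lemma hutchinson_invariant_maps:
  "hutchinson m f A = A \<Longrightarrow> i \<in> {1..m} \<Longrightarrow> x \<in> A \<Longrightarrow> f i x \<in> A"
  unfolding hutchinson_def by blast

section \<open>Uniform estimates at compact sets\<close>

text \<open>The radius is a Lebesgue number of the cover of \<open>C\<close> by the single open set
  \<open>U\<close>.\<close>

lemma compact_subset_open_uniform:
  assumes C: "compactin (mtopology_of D) C" and U: "openin (mtopology_of D) U" and "C \<subseteq> U"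
  obtains r where "r > 0" "\<And>a b. a \<in> C \<Longrightarrow> b \<in> mspace D \<Longrightarrow> mdist D a b < r \<Longrightarrow> b \<in> U"
proof -
  interpret Metric_space "mspace D" "mdist D" by simp
  have Cs: "C \<subseteq> mspace D" using C compactin_subset_topspace by fastforce
  obtain r where "r > 0" "\<forall>x\<in>C. \<exists>V\<in>{U}. mball x r \<subseteq> V"
    using lebesgue_number[of C "{U}"] C U \<open>C \<subseteq> U\<close> by (auto simp: mtopology_of_def)
  then show thesis using that[of r] Cs by (auto simp: subset_iff)
qed

text \<open>Unlike uniform continuity on \<open>C\<close>, only one of the two points is required to lie in \<open>C\<close>.\<close>

lemma uniform_continuity_at_compact:
  assumes C: "compactin (mtopology_of D) C" and F: "ifs D m f" and "\<eta> > 0"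
  obtains \<delta> where "\<delta> > 0"
    "\<And>i a b. i \<in> {1..m} \<Longrightarrow> a \<in> C \<Longrightarrow> b \<in> mspace D \<Longrightarrow> mdist D a b < \<delta> \<Longrightarrow>
       mdist D (f i a) (f i b) < \<eta>"
proof -
  interpret Metric_space "mspace D" "mdist D" by simp
  have m1: "1 \<in> {1..m}" using F by (simp add: ifs_def)
  have Cs: "C \<subseteq> mspace D" using C compactin_subset_topspace by fastforce
  \<comment> \<open>\<open>V c\<close> consists of the points that every map sends within
    \<open>\<eta>/2\<close> of the image of \<open>c\<close>. It is open as a finite nonempty
    intersection of preimages of balls, and a Lebesgue number of the cover of \<open>C\<close> by
    these sets serves as \<open>\<delta>\<close>.\<close>
  define V where "V c = (\<Inter>i\<in>{1..m}. {x \<in> mspace D. f i x \<in> mball (f i c) (\<eta>/2)})" for c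
  have "openin mtopology {x \<in> mspace D. f i x \<in> mball (f i c) (\<eta>/2)}" if "i \<in> {1..m}" for i c
    using openin_continuous_map_preimage[of mtopology mtopology "f i" "mball (f i c) (\<eta>/2)"]
      F that by (simp add: ifs_def mtopology_of_def)
  then have op: "openin mtopology (V c)" for c
    unfolding V_def by (intro openin_INT2) (use m1 in auto)
  have cV: "c \<in> V c" if "c \<in> C" for c
    using that Cs \<open>\<eta> > 0\<close> ifs_maps_space[OF F] by (auto simp: V_def)
  obtain \<delta> where \<delta>: "\<delta> > 0" "\<forall>a\<in>C. \<exists>U\<in>V ` C. mball a \<delta> \<subseteq> U"
  proof -
    have "compactin mtopology C" using C by (simp add: mtopology_of_def)
    moreover have "C \<subseteq> \<Union> (V ` C)" using cV by blast
    ultimately show thesis using lebesgue_number[of C "V ` C"] op that by blast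
  qed
  show thesis
  proof (rule that[OF \<delta>(1)])
    fix i a b assume *: "i \<in> {1..m}" "a \<in> C" "b \<in> mspace D" "mdist D a b < \<delta>"
    then obtain c where c: "c \<in> C" "mball a \<delta> \<subseteq> V c" using \<delta> by blast
    have "a \<in> mball a \<delta>" "b \<in> mball a \<delta>" using * Cs \<delta>(1) by auto
    then have "a \<in> V c" "b \<in> V c" using c by auto
    then have 1: "mdist D (f i c) (f i a) < \<eta>/2" "mdist D (f i c) (f i b) < \<eta>/2"
      "f i a \<in> mspace D" "f i b \<in> mspace D" "f i c \<in> mspace D"
      using *(1) by (auto simp: V_def)
    have "mdist D (f i a) (f i b) \<le> mdist D (f i c) (f i a) + mdist D (f i c) (f i b)"
      using triangle[of "f i a" "f i c" "f i b"] 1 by (simp add: commute)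
    then show "mdist D (f i a) (f i b) < \<eta>" using 1 by linarith
  qed
qed

text \<open>There are finitely many words of length \<open>n\<close>, so this is a finite union of
  continuous images of \<open>C\<close>. It is the compact set at which uniform continuity is
  applied when a shadowing orbit is extended by one step.\<close>

lemma compactin_words_image:
  assumes C: "compactin (mtopology_of D) C" and F: "ifs D m f"
  shows "compactin (mtopology_of D) (\<Union>I\<in>{I \<in> words m. length I = n}. word_map f I ` C)"
proof -
  have "continuous_map (mtopology_of D) (mtopology_of D) (word_map f I)" if "I \<in> words m" for I
    using that
  proof (induction I rule: rev_induct)
    case Nil
    then show ?case by (simp add: word_map_def)
  next
    case (snoc i I)
    then have "continuous_map (mtopology_of D) (mtopology_of D) (f i \<circ> word_map f I)"
      using F by (intro continuous_map_compose) (auto simp: ifs_def)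
    then show ?case by (simp add: comp_def)
  qed
  moreover have "finite {I \<in> words m. length I = n}"
    using finite_lists_length_eq[of "{1..m}" n] by (simp add: words_def lists_eq_set)
  ultimately show ?thesis
    by (intro compactin_Union) (auto intro: image_compactin[OF C])
qed

section \<open>Shadowing of fine chains by orbits\<close>

text \<open>The shadowing word is built letter by letter, copying the maps that the chain uses. Half
  of \<open>\<eta>\<close> pays for the jump of the last step, the other half for the image under
  the last map of the earlier error. Only the orbit point lies in a known compact set; the chain
  point is arbitrary, hence the one-sided form of uniform continuity.\<close>

lemma shadowing:
  assumes C: "compactin (mtopology_of D) C" and F: "ifs D m f" and "\<eta> > 0"
  shows "\<exists>\<epsilon>>0. \<forall>a\<in>C. \<forall>b. (a, b) \<in> chain_step D m f \<epsilon> ^^ n \<longrightarrow>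
           (\<exists>I\<in>words m. length I = n \<and> mdist D b (word_map f I a) < \<eta>)"
  using \<open>\<eta> > 0\<close>
proof (induction n arbitrary: \<eta>)
  interpret Metric_space "mspace D" "mdist D" by simp
  have Cs: "C \<subseteq> mspace D" using C compactin_subset_topspace by fastforce
  {
    case 0
    show ?case
      by (intro exI[of _ 1]) (use 0 Cs in \<open>auto intro!: bexI[of _ "[]"]\<close>)
  next
    case (Suc n)
    obtain \<delta> where \<delta>: "\<delta> > 0"
      "\<And>i a b. i \<in> {1..m} \<Longrightarrow> a \<in> (\<Union>I\<in>{I \<in> words m. length I = n}. word_map f I ` C) \<Longrightarrow>
         b \<in> mspace D \<Longrightarrow> mdist D a b < \<delta> \<Longrightarrow> mdist D (f i a) (f i b) < \<eta>/2"
      using that by (rule uniform_continuity_at_compact[OF compactin_words_image[OF C F] F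
            half_gt_zero[OF Suc.prems]])
    obtain \<epsilon> where \<epsilon>: "\<epsilon> > 0" "\<forall>a\<in>C. \<forall>b. (a, b) \<in> chain_step D m f \<epsilon> ^^ n \<longrightarrow>
           (\<exists>I\<in>words m. length I = n \<and> mdist D b (word_map f I a) < \<delta>)"
      using Suc.IH[OF \<delta>(1)] by blast
    show ?case
    \<comment> \<open>The first term makes the induction hypothesis available for the first
      \<open>n\<close> steps, the second bounds the last jump.\<close>
    proof (intro exI[of _ "min \<epsilon> (\<eta>/2)"] conjI ballI allI impI)
      show "min \<epsilon> (\<eta>/2) > 0" using \<epsilon> Suc.prems by simp
      fix a b assume a: "a \<in> C" and "(a, b) \<in> chain_step D m f (min \<epsilon> (\<eta>/2)) ^^ Suc n"
      then obtain w where w: "(a, w) \<in> chain_step D m f (min \<epsilon> (\<eta>/2)) ^^ n"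
        "(w, b) \<in> chain_step D m f (min \<epsilon> (\<eta>/2))" by auto
      obtain i where i: "i \<in> {1..m}" "mdist D (f i w) b < \<eta>/2" "w \<in> mspace D" "b \<in> mspace D"
        using w(2) by (auto simp: chain_step_def)
      obtain I where I: "I \<in> words m" "length I = n" "mdist D w (word_map f I a) < \<delta>"
        using \<epsilon>(2) a chain_step_relpow_mono[OF w(1), of \<epsilon>] by auto
      let ?u = "word_map f I a"
      have u: "?u \<in> mspace D"
        using word_map_in[of m "mspace D" f I a] ifs_maps_space[OF F] I a Cs by auto
      have "mdist D (f i ?u) (f i w) < \<eta>/2"
        using \<delta>(2)[OF i(1), of ?u w] I a i by (auto simp: commute)
      moreover have "mdist D b (f i ?u) \<le> mdist D (f i w) b + mdist D (f i ?u) (f i w)"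
        using triangle[of b "f i w" "f i ?u"] i u ifs_maps_space[OF F] by (simp add: commute)
      ultimately have "mdist D b (f i ?u) < \<eta>" using i by linarith
      then show "\<exists>I\<in>words m. length I = Suc n \<and> mdist D b (word_map f I a) < \<eta>"
        using I i by (intro bexI[of _ "I @ [i]"]) auto
    qed
  }
qed

text \<open>Only finitely many lengths are involved, so the least of their thresholds is still
  positive.\<close>

lemma shadowing_upto:
  assumes C: "compactin (mtopology_of D) C" and F: "ifs D m f" and "\<eta> > 0"
  obtains \<epsilon> where "\<epsilon> > 0"
    "\<And>n a b. n \<le> N \<Longrightarrow> a \<in> C \<Longrightarrow> (a, b) \<in> chain_step D m f \<epsilon> ^^ n \<Longrightarrow>
       \<exists>I\<in>words m. length I = n \<and> mdist D b (word_map f I a) < \<eta>"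
proof -
  obtain e where e: "\<And>n. e n > 0"
    "\<And>n a b. a \<in> C \<Longrightarrow> (a, b) \<in> chain_step D m f (e n) ^^ n \<Longrightarrow>
       \<exists>I\<in>words m. length I = n \<and> mdist D b (word_map f I a) < \<eta>"
    using shadowing[OF assms] by metis
  show thesis
  proof (rule that)
    show "Min (e ` {..N}) > 0" using e(1) by simp
    fix n a b assume "n \<le> N" "a \<in> C" "(a, b) \<in> chain_step D m f (Min (e ` {..N})) ^^ n"
    then show "\<exists>I\<in>words m. length I = n \<and> mdist D b (word_map f I a) < \<eta>"
      using e(2)[of a b n] chain_step_relpow_mono[of a b n D m f _ "e n"] by simp
  qed
qed

section \<open>Trapping of fine chains near the attractor\<close>

text \<open>The disjunction serves two uses: control from time \<open>T\<close> on for an arbitrary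
  start, which gives recurrence results, and control at all times for a start in \<open>G\<close>,
  which gives the restriction of the chain stream.\<close>

lemma trapping:
  assumes lc: "locally_compact_space (mtopology_of D)" and F: "ifs D m f"
    and G: "global_attractor D m f G" and x: "x \<in> mspace D" and "\<delta> > 0"
  obtains \<epsilon> T where "\<epsilon> > 0"
    "\<And>n z. (x, z) \<in> chain_step D m f \<epsilon> ^^ n \<Longrightarrow> n \<ge> T \<or> x \<in> G \<Longrightarrow> z \<in> nbhd D \<delta> G"
proof -
  interpret Metric_space "mspace D" "mdist D" by simp
  have Gc: "compactin (mtopology_of D) G" and Ginv: "hutchinson m f G = G"
    using G by (auto simp: global_attractor_def)
  have Gs: "G \<subseteq> mspace D" using Gc compactin_subset_topspace by fastforce
  have "Hausdorff_space (mtopology_of D)"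
    using Hausdorff_space_mtopology by (simp add: mtopology_of_def)
  then obtain U K where U: "openin (mtopology_of D) U" "compactin (mtopology_of D) K"
    "G \<subseteq> U" "U \<subseteq> K"
    using lc Gc locally_compact_space_compact_closed_compact by metis
  obtain r where r: "r > 0" "\<And>a b. a \<in> G \<Longrightarrow> b \<in> mspace D \<Longrightarrow> mdist D a b < r \<Longrightarrow> b \<in> U"
    using compact_subset_open_uniform[OF Gc U(1,3)] by blast
  \<comment> \<open>Shrinking to \<open>r\<close> puts the \<open>\<delta>'\<close>-neighbourhood of
    \<open>G\<close> inside \<open>K\<close>, so a chain point known to be near \<open>G\<close> can
    serve as a new starting point for shadowing.\<close>
  define \<delta>' where "\<delta>' = min \<delta> r"
  have d': "\<delta>' > 0" using r \<open>\<delta> > 0\<close> by (simp add: \<delta>'_def)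
  have in_K: "z \<in> K" if "z \<in> nbhd D \<delta>' G" for z
    using that r(2) U(4) by (force simp: mem_nbhd_iff \<delta>'_def commute)
  \<comment> \<open>\<open>C\<close> holds all points from which shadowing is started: the initial
    point \<open>x\<close>, which may lie far from \<open>G\<close>, and the restart points in
    \<open>K\<close>.\<close>
  define C where "C = insert x K"
  have C: "compactin (mtopology_of D) C"
    using U(2) x compactin_Un[of "mtopology_of D" "{x}" K] by (simp add: C_def)
  have Cs: "C \<subseteq> mspace D" using C compactin_subset_topspace by fastforce
  obtain T where T: "T > 0"
    "\<And>I. I \<in> words m \<Longrightarrow> T \<le> length I \<Longrightarrow> word_map f I ` C \<subseteq> nbhd D (\<delta>'/2) G"
    using G C d' unfolding global_attractor_def attracts_def by (metis half_gt_zero)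
  \<comment> \<open>The bound \<open>2*T\<close> leaves no gap: up to that time the chain is
    shadowed from \<open>x\<close>, and for \<open>n > 2*T\<close> the restart time
    \<open>n - T\<close> still exceeds \<open>T\<close>.\<close>
  obtain \<epsilon> where \<epsilon>: "\<epsilon> > 0"
    "\<And>n a b. n \<le> 2*T \<Longrightarrow> a \<in> C \<Longrightarrow> (a, b) \<in> chain_step D m f \<epsilon> ^^ n \<Longrightarrow>
       \<exists>I\<in>words m. length I = n \<and> mdist D b (word_map f I a) < \<delta>'/2"
    using that by (rule shadowing_upto[OF C F half_gt_zero[OF d']])
  have short: "b \<in> nbhd D \<delta>' G"
    if n: "n \<le> 2*T" and a: "a \<in> C" and ab: "(a, b) \<in> chain_step D m f \<epsilon> ^^ n"
      and *: "n \<ge> T \<or> a \<in> G" for a b n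
  proof -
    obtain I where I: "I \<in> words m" "length I = n" "mdist D b (word_map f I a) < \<delta>'/2"
      using \<epsilon>(2)[OF n a ab] by blast
    have "word_map f I a \<in> nbhd D (\<delta>'/2) G"
    \<comment> \<open>A long orbit is close to \<open>G\<close> by attraction; a short one starts in
      \<open>G\<close> and stays there by invariance.\<close>
    proof (cases "n \<ge> T")
      case True
      then show ?thesis using T(2)[of I] I a by blast
    next
      case False
      then have "word_map f I a \<in> G"
        using word_map_in[of m G f I a] hutchinson_invariant_maps[OF Ginv] I(1) * by blast
      then show ?thesis using Gs d' by (force simp: mem_nbhd_iff)
    qed
    then obtain g where g: "word_map f I a \<in> mspace D" "g \<in> G" "mdist D (word_map f I a) g < \<delta>'/2"
      by (auto simp: mem_nbhd_iff)
    have b: "b \<in> mspace D" using chain_step_relpow_in_mspace[OF ab] a Cs by blast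
    have "mdist D b g < \<delta>'"
      using triangle[of b "word_map f I a" g] b g Gs I by fastforce
    then show ?thesis using b g by (auto simp: mem_nbhd_iff)
  qed
  have trap: "z \<in> nbhd D \<delta>' G"
    if "(x, z) \<in> chain_step D m f \<epsilon> ^^ n" "n \<ge> T \<or> x \<in> G" for n z
    using that
  proof (induction n arbitrary: z rule: less_induct)
    case (less n)
    show ?case
    proof (cases "n \<le> 2*T")
      case True
      then show ?thesis using short[OF True _ less.prems(1)] less.prems(2) by (simp add: C_def)
    next
      case False
      then have "(x, z) \<in> chain_step D m f \<epsilon> ^^ (n - T) O chain_step D m f \<epsilon> ^^ T"
        using less.prems(1) relpow_add[of "n - T" T "chain_step D m f \<epsilon>"] by simp
      then obtain w where w: "(x, w) \<in> chain_step D m f \<epsilon> ^^ (n - T)"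
        "(w, z) \<in> chain_step D m f \<epsilon> ^^ T" by blast
      \<comment> \<open>Here \<open>n - T < n\<close> because \<open>T > 0\<close>, and
        \<open>n - T \<ge> T\<close> because \<open>n > 2*T\<close>, so the induction hypothesis
        places the restart point near \<open>G\<close>.\<close>
      have "w \<in> nbhd D \<delta>' G" by (rule less.IH[OF _ w(1)]) (use False T(1) in auto)
      then have "w \<in> C" using in_K by (simp add: C_def)
      then show ?thesis using short[OF _ _ w(2)] by simp
    qed
  qed
  have "nbhd D \<delta>' G \<subseteq> nbhd D \<delta> G" by (force simp: mem_nbhd_iff \<delta>'_def)
  with trap show thesis using that[OF \<epsilon>(1)] by blast
qed

section \<open>Chain-recurrent points lie in the attractor\<close>

lemma relpow_cycle: "(x, x) \<in> (R :: 'a rel) ^^ k \<Longrightarrow> (x, x) \<in> R ^^ (n * k)"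
  by (induction n) (auto simp: relpow_add)

lemma chain_recurrent_set_subset_attractor:
  assumes lc: "locally_compact_space (mtopology_of D)" and F: "ifs D m f"
    and G: "global_attractor D m f G"
  shows "chain_recurrent_set D m f \<subseteq> G"
proof
  interpret Metric_space "mspace D" "mdist D" by simp
  fix x assume "x \<in> chain_recurrent_set D m f"
  then obtain i where x: "x \<in> mspace D" and i: "i \<in> {1..m}" "(f i x, x) \<in> chain_stream D m f"
    by (auto simp: chain_recurrent_set_def chain_equiv_def)
  have "closedin (mtopology_of D) G"
    using G compactin_imp_closedin Hausdorff_space_mtopology
    by (auto simp: global_attractor_def mtopology_of_def)
  then show "x \<in> G"
  proof (rule mem_closed_if_mem_nbhds[OF _ x])
    fix \<delta> :: real assume "\<delta> > 0"
    obtain \<epsilon> T where \<epsilon>: "\<epsilon> > 0"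
      "\<And>n z. (x, z) \<in> chain_step D m f \<epsilon> ^^ n \<Longrightarrow> n \<ge> T \<or> x \<in> G \<Longrightarrow> z \<in> nbhd D \<delta> G"
      using that by (rule trapping[OF lc F G x \<open>\<delta> > 0\<close>])
    obtain k where k: "(f i x, x) \<in> chain_step D m f \<epsilon> ^^ k"
      using i(2) \<epsilon>(1) by (auto simp: chain_stream_iff)
    have fx: "f i x \<in> mspace D" using ifs_maps_space[OF F i(1) x] .
    \<comment> \<open>An exact step from \<open>x\<close> to \<open>f i x\<close> is put in front of
      the returning chain, so the closed chain has positive length even when
      \<open>k = 0\<close>.\<close>
    then have "mdist D (f i x) (f i x) < \<epsilon>" using \<epsilon>(1) by simp
    then have "(x, f i x) \<in> chain_step D m f \<epsilon>"
      using x fx i(1) unfolding chain_step_def by blast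
    then have "(x, x) \<in> chain_step D m f \<epsilon> ^^ Suc k" using k by (rule relpow_Suc_I2)
    \<comment> \<open>After \<open>T\<close> rounds the length is at least \<open>T\<close>, so
      trapping applies to the endpoint, which is \<open>x\<close> itself.\<close>
    then have "(x, x) \<in> chain_step D m f \<epsilon> ^^ (T * Suc k)" by (rule relpow_cycle)
    then show "x \<in> nbhd D \<delta> G" by (rule \<epsilon>(2)) simp
  qed
qed

section \<open>The chain stream inside the attractor\<close>

text \<open>One inclusion holds since chains in \<open>G\<close> are chains in the space. For the
  other, each intermediate point of a fine chain between points of \<open>G\<close> is replaced by a
  nearby point of \<open>G\<close>.\<close>

lemma chain_stream_restrict:
  assumes lc: "locally_compact_space (mtopology_of D)" and F: "ifs D m f"
    and G: "global_attractor D m f G"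
  shows "chain_stream D m f \<inter> (G \<times> G) = chain_stream (submetric D G) m (restrict_maps G f)"
proof -
  interpret Metric_space "mspace D" "mdist D" by simp
  let ?S = "\<lambda>\<epsilon>. chain_step (submetric D G) m (restrict_maps G f) \<epsilon>"
  have Gc: "compactin (mtopology_of D) G" and Ginv: "hutchinson m f G = G"
    using G by (auto simp: global_attractor_def)
  have Gs: "G \<subseteq> mspace D" using Gc compactin_subset_topspace by fastforce
  have S: "?S \<epsilon> = chain_step D m f \<epsilon> \<inter> G \<times> G" for \<epsilon>
    using Gs by (auto simp: chain_step_def restrict_maps_def)
  show ?thesis
  proof (intro equalityI subrelI)
    fix x y assume xy: "(x, y) \<in> chain_stream (submetric D G) m (restrict_maps G f)"
    have "?S \<epsilon> \<subseteq> chain_step D m f \<epsilon>" for \<epsilon> using S by blast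
    then have "(x, y) \<in> chain_stream D m f"
      using xy relpow_mono_subset unfolding chain_stream_iff by (metis IntD2 mspace_submetric subsetD)
    then show "(x, y) \<in> chain_stream D m f \<inter> G \<times> G"
      using chain_stream_subset_mspace[of "submetric D G"] xy by fastforce
  next
    fix x y assume "(x, y) \<in> chain_stream D m f \<inter> G \<times> G"
    then have xy: "(x, y) \<in> chain_stream D m f" "x \<in> G" "y \<in> G" by auto
    have x: "x \<in> mspace D" using xy Gs by blast
    have "\<exists>k. (x, y) \<in> ?S \<epsilon> ^^ k" if "\<epsilon> > 0" for \<epsilon>
    proof -
      obtain \<delta> where \<delta>: "\<delta> > 0"
        "\<And>i a b. i \<in> {1..m} \<Longrightarrow> a \<in> G \<Longrightarrow> b \<in> mspace D \<Longrightarrow> mdist D a b < \<delta> \<Longrightarrow>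
           mdist D (f i a) (f i b) < \<epsilon>/3"
        using uniform_continuity_at_compact[OF Gc F, of "\<epsilon>/3"] \<open>\<epsilon> > 0\<close> by auto
      \<comment> \<open>Error budget for one moved step: moving its source changes the image by less
        than \<open>\<epsilon>/3\<close> through \<open>\<delta>\<close>, moving its target costs
        less than \<open>\<epsilon>/3\<close>, and the original jump is below
        \<open>e \<le> \<epsilon>/3\<close>.\<close>
      define \<delta>' where "\<delta>' = min \<delta> (\<epsilon>/3)"
      have d': "\<delta>' > 0" using \<delta> \<open>\<epsilon> > 0\<close> by (simp add: \<delta>'_def)
      obtain \<epsilon>1 T where \<epsilon>1: "\<epsilon>1 > 0"
        "\<And>n z. (x, z) \<in> chain_step D m f \<epsilon>1 ^^ n \<Longrightarrow> n \<ge> T \<or> x \<in> G \<Longrightarrow> z \<in> nbhd D \<delta>' G"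
        using that by (rule trapping[OF lc F G x d'])
      define e where "e = min \<epsilon>1 (\<epsilon>/3)"
      have e: "e > 0" using \<epsilon>1 \<open>\<epsilon> > 0\<close> by (simp add: e_def)
      have near: "z \<in> nbhd D \<delta>' G" if "(x, z) \<in> chain_step D m f e ^^ n" for z n
        using \<epsilon>1(2)[of z n] chain_step_relpow_mono[OF that, of \<epsilon>1] xy by (simp add: e_def)
      \<comment> \<open>The replacement \<open>z'\<close> of the last point is left free so that the
        induction can use whichever point of \<open>G\<close> was chosen, and so that the final
        point can be kept. The condition for \<open>n = 0\<close> keeps the initial point
        \<open>x\<close> fixed.\<close>
      have move: "(x, z') \<in> ?S \<epsilon> ^^ n"
        if "(x, z) \<in> chain_step D m f e ^^ n" "z' \<in> G" "mdist D z' z < \<delta>'" "n = 0 \<Longrightarrow> z' = x"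
        for z z' n
        using that
      proof (induction n arbitrary: z z')
        case 0
        then show ?case by simp
      next
        case (Suc n)
        then obtain w where w: "(x, w) \<in> chain_step D m f e ^^ n" "(w, z) \<in> chain_step D m f e"
          by auto
        obtain i where i: "i \<in> {1..m}" "mdist D (f i w) z < e" "w \<in> mspace D" "z \<in> mspace D"
          using w(2) by (auto simp: chain_step_def)
        obtain w' where w': "w' \<in> G" "mdist D w' w < \<delta>'" "n = 0 \<Longrightarrow> w' = x"
        proof (cases "n = 0")
          case True
          then show ?thesis using that[of x] w xy x d' by simp
        next
          case False
          then show ?thesis using that near[OF w(1)] by (auto simp: mem_nbhd_iff commute)
        qed
        have "(x, w') \<in> ?S \<epsilon> ^^ n" using Suc.IH[OF w(1) w'] by blast
        moreover have "(w', z') \<in> ?S \<epsilon>"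
        proof -
          have in_D: "w' \<in> mspace D" "z' \<in> mspace D" using w' Suc.prems Gs by auto
          then have fD: "f i w' \<in> mspace D" "f i w \<in> mspace D"
            using i ifs_maps_space[OF F] by auto
          have "mdist D (f i w') z' \<le> mdist D (f i w') (f i w) + mdist D (f i w) z + mdist D z' z"
            using triangle[of "f i w'" "f i w" z'] triangle[of "f i w" z z'] fD in_D i
            by (simp add: commute)
          moreover have "mdist D (f i w') (f i w) < \<epsilon>/3"
            using \<delta>(2)[OF i(1) w'(1) i(3)] w'(2) by (simp add: \<delta>'_def)
          ultimately have "mdist D (f i w') z' < \<epsilon>"
            using i(2) Suc.prems(3) by (simp add: e_def \<delta>'_def)
          then have "(w', z') \<in> chain_step D m f \<epsilon>"
            using in_D i(1) unfolding chain_step_def by blast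
          then show ?thesis using S w'(1) Suc.prems(2) by simp
        qed
        ultimately show ?case by auto
      qed
      obtain k where k: "(x, y) \<in> chain_step D m f e ^^ k"
        using xy(1) e by (auto simp: chain_stream_iff)
      \<comment> \<open>Here \<open>y\<close> replaces itself, being already in \<open>G\<close>; if
        \<open>k = 0\<close>, the chain forces \<open>y = x\<close>.\<close>
      have "(x, y) \<in> ?S \<epsilon> ^^ k"
        by (rule move[OF k xy(3)]) (use k xy Gs d' in auto)
      then show ?thesis by blast
    qed
    then show "(x, y) \<in> chain_stream (submetric D G) m (restrict_maps G f)"
      using x xy by (simp add: chain_stream_iff)
  qed
qed

section \<open>Transfer to recurrent sets, nodes and graphs\<close>

lemma word_map_restrict:
  assumes A: "\<And>i x. i \<in> {1..m} \<Longrightarrow> x \<in> A \<Longrightarrow> f i x \<in> A" and "I \<in> words m" and "x \<in> A"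
  shows "word_map (restrict_maps A f) I x = word_map f I x"
  using assms(2)
proof (induction I rule: rev_induct)
  case Nil
  then show ?case by simp
next
  case (snoc i I)
  then have "word_map f I x \<in> A"
    using word_map_in[of m A f I x] A \<open>x \<in> A\<close> by simp
  with snoc show ?case by (simp add: restrict_maps_def)
qed

lemma chain_classes_cong:
  assumes "\<And>x y. x \<in> R \<Longrightarrow> y \<in> R \<Longrightarrow> chain_equiv D m f x y = chain_equiv D' m f' x y"
  shows "chain_classes D m f R = chain_classes D' m f' R"
proof -
  have "{(x, y). x \<in> R \<and> y \<in> R \<and> chain_equiv D m f x y} =
        {(x, y). x \<in> R \<and> y \<in> R \<and> chain_equiv D' m f' x y}"
    using assms by blast
  then show ?thesis by (simp add: chain_classes_def)
qed

lemma chain_classes_subset: "N \<in> chain_classes D m f R \<Longrightarrow> N \<subseteq> R"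
  by (auto simp: chain_classes_def quotient_def)

text \<open>Edges test the stream only at pairs of points of nodes, and these pairs lie in
  \<open>G \<times> G\<close>.\<close>

lemma node_graph_cong:
  assumes N: "\<And>N. N \<in> \<N> \<Longrightarrow> N \<subseteq> G"
    and C: "chain_stream D m f \<inter> (G \<times> G) = chain_stream D' m f' \<inter> (G \<times> G)"
  shows "node_graph D m f \<N> = node_graph D' m f' \<N>"
proof -
  have *: "(x, y) \<in> chain_stream D m f \<longleftrightarrow> (x, y) \<in> chain_stream D' m f'"
    if "N1 \<in> \<N>" "N2 \<in> \<N>" "x \<in> N1" "y \<in> N2" for N1 N2 x y
  proof -
    have "(x, y) \<in> G \<times> G" using N[OF that(1)] N[OF that(2)] that(3,4) by auto
    then show ?thesis using C by (metis IntD1 IntI)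
  qed
  show ?thesis
    unfolding node_graph_def by (simp, safe) (use * in blast)+
qed

theorem theorem3:
  fixes X :: "'a topology" and D :: "'a metric"
    and m :: nat and f :: "nat \<Rightarrow> 'a \<Rightarrow> 'a" and G :: "'a set"
  assumes "metrizable_space X" and "separable_space X" and "locally_compact_space X"
    and "mtopology_of D = X"
    and "ifs D m f" and "compact_dynamics D m f" and "global_attractor D m f G"
  shows "chain_stream D m f \<inter> (G \<times> G) = chain_stream (submetric D G) m (restrict_maps G f)
    \<and> chain_recurrent_set D m f = chain_recurrent_set (submetric D G) m (restrict_maps G f)
    \<and> chain_nodes D m f = chain_nodes (submetric D G) m (restrict_maps G f)
    \<and> chain_graph D m f = chain_graph (submetric D G) m (restrict_maps G f)
    \<and> orbitwise_chain_recurrent_set D m f =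
        orbitwise_chain_recurrent_set (submetric D G) m (restrict_maps G f)
    \<and> orbitwise_chain_nodes D m f = orbitwise_chain_nodes (submetric D G) m (restrict_maps G f)
    \<and> orbitwise_chain_graph D m f = orbitwise_chain_graph (submetric D G) m (restrict_maps G f)"
proof -
  let ?D = "submetric D G" and ?f = "restrict_maps G f"
  have lc: "locally_compact_space (mtopology_of D)" using assms by simp
  note F = \<open>ifs D m f\<close> and GA = \<open>global_attractor D m f G\<close>
  have Gc: "compactin (mtopology_of D) G" and Ginv: "hutchinson m f G = G"
    using GA by (auto simp: global_attractor_def)
  have Gs: "G \<subseteq> mspace D" using Gc compactin_subset_topspace by fastforce
  have fG: "f i x \<in> G" if "i \<in> {1..m}" "x \<in> G" for i x
    using hutchinson_invariant_maps[OF Ginv that] .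
  have stream: "chain_stream D m f \<inter> (G \<times> G) = chain_stream ?D m ?f"
    by (rule chain_stream_restrict[OF lc F GA])
  have equiv: "chain_equiv D m f x y = chain_equiv ?D m ?f x y" if "x \<in> G" "y \<in> G" for x y
    using that by (auto simp: chain_equiv_def simp flip: stream)
  have orbit: "ifs_orbit m ?f x = ifs_orbit m f x" if "x \<in> G" for x
    using word_map_restrict[of m G f _ x] fG that unfolding ifs_orbit_def by metis
  have orbit_G: "y \<in> G" if "y \<in> ifs_orbit m f x" "x \<in> G" for x y
    using that word_map_in[of m G f _ x] fG by (auto simp: ifs_orbit_def)
  have R_G: "chain_recurrent_set D m f \<subseteq> G"
    by (rule chain_recurrent_set_subset_attractor[OF lc F GA])
  \<comment> \<open>Since \<open>m \<ge> 1\<close>, the one-letter word \<open>[1]\<close> is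
    available. An orbitwise chain-recurrent point is thus chain-equivalent to \<open>f 1 x\<close>,
    hence chain-recurrent and in \<open>G\<close>.\<close>
  have "f 1 x \<in> ifs_orbit m f x" for x
    using F unfolding ifs_orbit_def
    by (intro CollectI exI[of _ "[1]"]) (auto simp: word_map_def words_def ifs_def)
  then have OR_R: "orbitwise_chain_recurrent_set D m f \<subseteq> chain_recurrent_set D m f"
    using F by (force simp: orbitwise_chain_recurrent_set_def chain_recurrent_set_def ifs_def)
  have R: "chain_recurrent_set D m f = chain_recurrent_set ?D m ?f"
  proof -
    \<comment> \<open>Once the ambient recurrent set is known to lie in \<open>G\<close>, both sides
      range over \<open>G\<close>, where the two chain equivalences agree because
      \<open>f i x\<close> is again in \<open>G\<close>.\<close>
    have "chain_recurrent_set D m f = {x \<in> G. \<exists>i\<in>{1..m}. chain_equiv D m f x (f i x)}"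
      using R_G Gs by (auto simp: chain_recurrent_set_def)
    also have "\<dots> = chain_recurrent_set ?D m ?f"
    proof -
      have "chain_equiv D m f x (f i x) = chain_equiv ?D m ?f x (?f i x)"
        if "x \<in> G" "i \<in> {1..m}" for x i
        using equiv fG that by (simp add: restrict_maps_def)
      moreover have "mspace ?D = G" using Gs by auto
      ultimately show ?thesis unfolding chain_recurrent_set_def by blast
    qed
    finally show ?thesis .
  qed
  have OR: "orbitwise_chain_recurrent_set D m f = orbitwise_chain_recurrent_set ?D m ?f"
  proof -
    have "orbitwise_chain_recurrent_set D m f =
        {x \<in> G. \<forall>y\<in>ifs_orbit m f x. chain_equiv D m f x y}"
      using R_G OR_R Gs by (auto simp: orbitwise_chain_recurrent_set_def)
    also have "\<dots> = orbitwise_chain_recurrent_set ?D m ?f"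
      using Gs equiv orbit orbit_G by (auto simp: orbitwise_chain_recurrent_set_def)
    finally show ?thesis .
  qed
  have nodes: "chain_classes D m f A = chain_classes ?D m ?f A" if "A \<subseteq> G" for A
    using that equiv by (intro chain_classes_cong) auto
  have graph: "node_graph D m f \<N> = node_graph ?D m ?f \<N>"
    if "\<N> = chain_classes D m f A" "A \<subseteq> G" for \<N> A
    using that chain_classes_subset stream by (intro node_graph_cong[of _ G]) blast+
  have CN: "chain_nodes D m f = chain_nodes ?D m ?f"
    using nodes[OF R_G] R by (simp add: chain_nodes_def)
  have OCN: "orbitwise_chain_nodes D m f = orbitwise_chain_nodes ?D m ?f"
    using nodes[of "orbitwise_chain_recurrent_set D m f"] R_G OR_R OR
    by (simp add: orbitwise_chain_nodes_def)
  have "chain_graph D m f = chain_graph ?D m ?f"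
    using graph[OF chain_nodes_def R_G] CN by (simp add: chain_graph_def)
  moreover have "orbitwise_chain_graph D m f = orbitwise_chain_graph ?D m ?f"
    using graph[OF orbitwise_chain_nodes_def] R_G OR_R OCN by (simp add: orbitwise_chain_graph_def)
  ultimately show ?thesis using stream R CN OR OCN by blast
qed

end
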